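(* Let $\mathbf e\in\mathbb R^2$ be a unit vector, $\theta_0\in\mathbb R$, and $\tilde{\mathbf X}^0=(\tilde{\mathbf x}_1^0,\tilde{\mathbf x}_2^0,\tilde{\mathbf x}_3^0)\in S_{\mathbf e}^3(\mathbf 0,\theta_0)$, and put $r_0=|\tilde{\mathbf x}_1^0|$. Then the self-similar solution $\tilde{\mathbf X}(t)=\frac{1}{r_0}\sqrt{4t+r_0^2}\;\tilde{\mathbf X}^0$ of the system $$\dot{\mathbf x}_j(t)=2m_j\sum_{k=1,k\ne j}^3 m_k\frac{\mathbf x_j(t)-\mathbf x_k(t)}{|\mathbf x_j(t)-\mathbf x_k(t)|^2},\qquad 1\le j\le 3,$$ with $m_1=m_2=m_3\in\{+1,-1\}$ is orbitally stable.
   Context: $\mathbb R_*^{2\times N}:=\{(\mathbf x_1,\dots,\mathbf x_N)\in\mathbb R^{2\times N} : \mathbf x_j\neq\mathbf x_l\in\mathbb R^2 \text{ for } 1\le j<l\le N\}$. $Q(\theta)=\begin{pmatrix}\cos\theta&-\sin\theta\\ \sin\theta&\cos\theta\end{pmatrix}$, and for $\mathbf X=(\mathbf x_1,\dots,\mathbf x_N)$, $Q(\theta)\mathbf X:=(Q(\theta)\mathbf x_1,\dots,Q(\theta)\mathbf x_N)$. $S_{\mathbf e}^3(\mathbf 0,\theta_0)$ is the set of all $(r\mathbf x_1^{(0)},r\mathbf x_2^{(0)},r\mathbf x_3^{(0)})$ with $r>0$, where $\mathbf x_j^{(0)}=Q\big(\tfrac{2(j-1)\pi}{3}+\theta_0\big)\mathbf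 e$, $j=1,2,3$. Orbital stability of $\tilde{\mathbf X}(t)$: for every $\varepsilon>0$ there exists $\delta>0$ such that, whenever the initial data $\mathbf X^0=(\mathbf x_1^0,\mathbf x_2^0,\mathbf x_3^0)\in\mathbb R_*^{2\times3}$ satisfies $\|\mathbf X^0-\tilde{\mathbf X}^0\|_2<\delta$, the solution $\mathbf X(t)$ of the system with $\mathbf X(0)=\mathbf X^0$ satisfies $$\sup_{t\ge0}\ \inf_{r>0,\ \theta\in[0,2\pi)}\ \big\|\mathbf X(t)-\bar{\mathbf x}^0-rQ(\theta)\tilde{\mathbf X}(t)\big\|_2<\varepsilon,$$ where $\bar{\mathbf x}^0=\frac13\sum_{j=1}^3\mathbf x_j^0$ is subtracted from each of the three columns of $\mathbf X(t)$, and $\|\cdot\|_2$ is the Euclidean norm on $\mathbb R^{2\times3}$. *)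

theory Defs
  imports "HOL-Analysis.Analysis"
begin

text \<open>
  A configuration of points of the plane is an element \<open>X\<close> of \<open>real ^ 2 ^ 'n\<close>; its columns are the
  points \<open>X $ j :: real ^ 2\<close>. The norm of the type \<open>real ^ 2 ^ 'n\<close> is the Euclidean (Frobenius) norm.
  For \<open>'n = 3\<close> the indices are \<open>1, 2, 3\<close> (where \<open>3 = 0\<close> in the index type).
\<close>

definition distinct_configs :: "(real ^ 2 ^ 'n) set" where
  "distinct_configs = {X. \<forall>j l. j \<noteq> l \<longrightarrow> X $ j \<noteq> X $ l}"

definition rot :: "real \<Rightarrow> real ^ 2 ^ 2" where
  "rot \<theta> = vector [vector [cos \<theta>, - sin \<theta>], vector [sin \<theta>, cos \<theta>]]"

definition rot_config :: "real \<Rightarrow> real ^ 2 ^ 'n \<Rightarrow> real ^ 2 ^ 'n" where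
  "rot_config \<theta> X = (\<chi> j. rot \<theta> *v (X $ j))"

definition regular_triangles :: "real ^ 2 \<Rightarrow> real \<Rightarrow> (real ^ 2 ^ 3) set" where
  "regular_triangles e \<theta>\<^sub>0 =
    {vector (map (\<lambda>j. r *\<^sub>R (rot (2 * (j - 1) * pi / 3 + \<theta>\<^sub>0) *v e)) [1, 2, 3]) | r :: real. r > 0}"

definition velocity :: "('n::finite \<Rightarrow> real) \<Rightarrow> real ^ 2 ^ 'n \<Rightarrow> 'n \<Rightarrow> real ^ 2" where
  "velocity m X j =
    (2 * m j) *\<^sub>R (\<Sum>k\<in>UNIV - {j}. (m k / (norm (X $ j - X $ k))\<^sup>2) *\<^sub>R (X $ j - X $ k))"

text \<open>Solutions are global in forward time and collision-free; the derivative at \<open>0\<close> is one-sided,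
  and the values of \<open>X\<close> at negative times are irrelevant.\<close>

definition is_solution :: "('n::finite \<Rightarrow> real) \<Rightarrow> (real \<Rightarrow> real ^ 2 ^ 'n) \<Rightarrow> bool" where
  "is_solution m X \<longleftrightarrow>
    (\<forall>t\<ge>0. X t \<in> distinct_configs \<and>
      (\<forall>j. ((\<lambda>s. X s $ j) has_vector_derivative velocity m (X t) j) (at t within {0..})))"

definition barycenter :: "real ^ 2 ^ 3 \<Rightarrow> real ^ 2" where
  "barycenter X = (1 / 3) *\<^sub>R (\<Sum>j\<in>UNIV. X $ j)"

text \<open>``The solution with initial data \<open>X0\<close>'' is rendered as: a solution on all of \<open>[0, \<infinity>)\<close> exists,
  it is unique there, and it satisfies the estimate. Supremum and infimum are taken in
  \<^typ>\<open>ereal\<close>, so that an unbounded supremum is \<open>\<infinity>\<close>.\<close>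

definition orbitally_stable :: "(3 \<Rightarrow> real) \<Rightarrow> (real \<Rightarrow> real ^ 2 ^ 3) \<Rightarrow> bool" where
  "orbitally_stable m Xt \<longleftrightarrow>
    (\<forall>\<epsilon>>0. \<exists>\<delta>>0. \<forall>X0\<in>distinct_configs. norm (X0 - Xt 0) < \<delta> \<longrightarrow>
      (\<exists>X. is_solution m X \<and> X 0 = X0 \<and>
        (\<forall>Y. is_solution m Y \<and> Y 0 = X0 \<longrightarrow> (\<forall>t\<ge>0. Y t = X t)) \<and>
        (SUP t\<in>{0..}. INF (r, \<theta>)\<in>{0<..} \<times> {0..<2 * pi}.
          ereal (norm (X t - (\<chi> j. barycenter X0) - r *\<^sub>R rot_config \<theta> (Xt t)))) < ereal \<epsilon>))"

end

theory Submission
  imports Defs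
begin

text \<open>
  Identify the plane with the complex numbers and write a triangle as
  \<open>x\<^sub>j = s + \<omega>\<^bsup>j-1\<^esup> a + \<omega>\<^bsup>-(j-1)\<^esup> b\<close> with \<open>\<omega>\<close> a primitive cube root of unity. The regular triangles
  of the orbit are those with \<open>b = 0\<close>, so the distance to the orbit is at most \<open>3 |b|\<close>. In these
  coordinates \<open>s\<close> is constant and the system becomes
  \<open>cnj a' = 2 a\<^sup>2 / (a\<^sup>3 - b\<^sup>3)\<close>, \<open>cnj b' = - 2 b\<^sup>2 / (a\<^sup>3 - b\<^sup>3)\<close>.
  Replace \<open>a\<close> and \<open>b\<close> on the right-hand side by their nearest points in a half-plane \<open>u \<bullet> a \<ge> c\<close> and
  a small disc \<open>|b| \<le> \<rho>\<close>. The resulting field is globally Lipschitz, hence has a global solution, and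
  along it \<open>u \<bullet> a\<close> is nondecreasing and \<open>|a|\<^sup>2\<close> grows at least like \<open>c\<^sup>2 + 2 t\<close>. Therefore
  \<open>|b'| \<le> 4 \<rho>\<^sup>2 / |a|\<^sup>3\<close> has integral at most \<open>4 \<rho>\<^sup>2 / c\<close>, the truncation is never active, and \<open>b\<close> stays small.
\<close>

section \<open>Global existence and uniqueness for ordinary differential equations\<close>

text \<open>The weight \<open>exp (2 * K * s)\<close> grows at rate \<open>2 * K\<close>, so
  integrating \<open>K\<close> times it gains a factor 1/2, uniformly in \<open>t\<close>. The same
  estimate keeps the Picard operator within the bounded functions and makes it contract.\<close>

lemma norm_weighted_integral_le:
  fixes h :: "real \<Rightarrow> 'a::banach"
  assumes "K > 0" "t \<ge> 0" "continuous_on {0..t} h"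
    and "\<And>s. s \<in> {0..t} \<Longrightarrow> norm (h s) \<le> M * (K * exp (2 * K * s))"
  shows "norm (exp (- 2 * K * t) *\<^sub>R integral {0..t} h) \<le> M / 2"
proof -
  \<comment> \<open>Evaluating the bound at \<open>s = 0\<close> forces \<open>M\<close> to be
    nonnegative.\<close>
  have "0 \<le> M * K"
    using assms(4)[of 0] assms(2) order_trans[OF norm_ge_zero[of "h 0"]] by simp
  then have M: "0 \<le> M" using assms(1) by (simp add: zero_le_mult_iff)
  have int: "((\<lambda>s. M * (K * exp (2 * K * s))) has_integral
      M / 2 * exp (2 * K * t) - M / 2 * exp (2 * K * 0)) {0..t}"
    using assms(2)
    by (intro fundamental_theorem_of_calculus)
       (auto intro!: derivative_eq_intros simp flip: has_real_derivative_iff_has_vector_derivative)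
  have "norm (integral {0..t} h) \<le> integral {0..t} (\<lambda>s. M * (K * exp (2 * K * s)))"
    using assms int by (intro integral_norm_bound_integral integrable_continuous_interval)
      (auto intro!: continuous_intros)
  also have "\<dots> = M / 2 * exp (2 * K * t) - M / 2"
    unfolding integral_unique[OF int] by simp
  also have "\<dots> \<le> M / 2 * exp (2 * K * t)" using M by simp
  finally have "exp (- 2 * K * t) * norm (integral {0..t} h)
      \<le> exp (- 2 * K * t) * (M / 2 * exp (2 * K * t))"
    by (intro mult_left_mono) auto
  also have "\<dots> = M / 2" by (simp add: exp_minus)
  finally show ?thesis by simp
qed

text \<open>In terms of \<open>v\<close> with \<open>x t = x0 + exp (2 * K * t) *\<^sub>R v t\<close> the Picard operator is a contraction of
  the bounded continuous functions on the whole half-line.\<close>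

lemma lipschitz_ode_global_solution:
  fixes F :: "'a::banach \<Rightarrow> 'a"
  assumes lip: "L-lipschitz_on UNIV F"
  obtains x where "x 0 = x0"
    "\<And>t. t \<ge> 0 \<Longrightarrow> (x has_vector_derivative F (x t)) (at t within {0..})"
proof -
  \<comment> \<open>Adding 1 keeps the rate strictly positive even when
    \<open>L = 0\<close>.\<close>
  define K where "K = L + 1"
  have L0: "0 \<le> L" using lip by (rule lipschitz_on_nonneg)
  have K: "K > 0" using L0 by (simp add: K_def)
  have lipK: "norm (F p - F q) \<le> K * norm (p - q)" for p q
  proof -
    have "norm (F p - F q) \<le> L * norm (p - q)"
      using lipschitz_onD[OF lip, of p q] by (simp add: dist_norm)
    also have "\<dots> \<le> K * norm (p - q)" by (simp add: K_def mult_right_mono)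
    finally show ?thesis .
  qed
  have contF: "continuous_on UNIV F" using lip by (rule lipschitz_on_continuous_on)
  define h where "h v s = F (x0 + exp (2 * K * s) *\<^sub>R v s)" for v :: "real \<Rightarrow> 'a" and s
  \<comment> \<open>Bounded continuous functions live on the whole line; \<open>max 0 t\<close>
    extends the operator to negative times by its value 0 at time 0.\<close>
  define P where "P v t = exp (- 2 * K * max 0 t) *\<^sub>R integral {0..max 0 t} (h v)" for v t
  have conth: "continuous_on S (h (apply_bcontfun v))" for v S
    unfolding h_def
    by (rule continuous_on_compose2[OF contF])
       (auto intro!: continuous_intros continuous_on_apply_bcontfun)
  have P_bcont: "P (apply_bcontfun v) \<in> bcontfun" for v
  proof (rule bcontfun_normI)
    have "continuous_on {0..} (\<lambda>t. integral {0..t} (h (apply_bcontfun v)))"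
      unfolding continuous_on_eq_continuous_within
    proof
      fix t :: real assume t: "t \<in> {0..}"
      have "continuous_on {0..t+1} (\<lambda>t. integral {0..t} (h (apply_bcontfun v)))"
        by (intro indefinite_integral_continuous_1 integrable_continuous_interval conth)
      then have "continuous (at t within {0..t+1}) (\<lambda>t. integral {0..t} (h (apply_bcontfun v)))"
        using t by (auto simp: continuous_on_eq_continuous_within)
      moreover have "at t within {0..t+1} = at t within {0..}"
        by (rule at_within_nhd[of _ "{..<t+1}"]) auto
      ultimately show "continuous (at t within {0..}) (\<lambda>t. integral {0..t} (h (apply_bcontfun v)))"
        by simp
    qed
    then have "continuous_on UNIV (\<lambda>t. integral {0..max 0 t} (h (apply_bcontfun v)))"
      by (rule continuous_on_compose2) (auto intro!: continuous_intros)
    then show "continuous_on UNIV (P (apply_bcontfun v))"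
      unfolding P_def by (intro continuous_intros)
    fix t :: real
    \<comment> \<open>Comparing \<open>F\<close> with its value at \<open>x0\<close> leaves the
      constant \<open>norm (F x0)\<close>, which the weight absorbs because it is at least
      1.\<close>
    show "norm (P (apply_bcontfun v) t) \<le> (norm (F x0) / K + norm v) / 2"
      unfolding P_def
    proof (rule norm_weighted_integral_le[OF K _ conth])
      fix s :: real assume s: "s \<in> {0..max 0 t}"
      then have e: "1 \<le> exp (2 * K * s)" using K by simp
      have "norm (h v s) \<le> norm (F x0) + norm (h v s - F x0)"
        using norm_triangle_ineq[of "F x0" "h v s - F x0"] by simp
      also have "norm (h v s - F x0) \<le> K * norm (exp (2 * K * s) *\<^sub>R v s)"
        unfolding h_def using lipK[of "x0 + exp (2 * K * s) *\<^sub>R v s" x0] by simp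
      also have "\<dots> \<le> K * (exp (2 * K * s) * norm v)"
        using K norm_bounded[of v s] by (auto intro!: mult_left_mono)
      also have "norm (F x0) \<le> norm (F x0) * exp (2 * K * s)"
        using e by (simp add: mult_le_cancel_left1)
      finally show "norm (h v s) \<le> (norm (F x0) / K + norm v) * (K * exp (2 * K * s))"
        using K by (simp add: distrib_left distrib_right mult_ac)
    qed auto
  qed
  define T where "T v = Bcontfun (P (apply_bcontfun v))" for v
  have T: "apply_bcontfun (T v) = P (apply_bcontfun v)" for v
    unfolding T_def by (rule Bcontfun_inverse[OF P_bcont])
  have "\<exists>!v. T v = v"
  proof (rule banach_fix_type[where c = "1/2"]; (intro allI)?)
    fix v w :: "real \<Rightarrow>\<^sub>C 'a"
    have "dist (T v t) (T w t) \<le> dist v w / 2" for t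
    proof -
      define \<tau> where "\<tau> = max 0 t"
      have "T v t - T w t = exp (- 2 * K * \<tau>) *\<^sub>R integral {0..\<tau>} (\<lambda>s. h v s - h w s)"
        unfolding T P_def \<tau>_def
        by (subst integral_diff) (auto intro!: integrable_continuous_interval conth simp: algebra_simps)
      moreover have "norm \<dots> \<le> dist v w / 2"
      proof (rule norm_weighted_integral_le[OF K])
        fix s
        have "norm (h v s - h w s) \<le> K * norm (exp (2 * K * s) *\<^sub>R v s - exp (2 * K * s) *\<^sub>R w s)"
          unfolding h_def
          using lipK[of "x0 + exp (2 * K * s) *\<^sub>R v s" "x0 + exp (2 * K * s) *\<^sub>R w s"] by simp
        also have "\<dots> = K * (exp (2 * K * s) * dist (v s) (w s))"
          by (simp add: dist_norm flip: scaleR_diff_right)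
        also have "\<dots> \<le> K * (exp (2 * K * s) * dist v w)"
          using K dist_bounded[of v s w] by (auto intro!: mult_left_mono)
        finally show "norm (h v s - h w s) \<le> dist v w * (K * exp (2 * K * s))"
          by (simp add: mult_ac)
      qed (auto simp: \<tau>_def intro!: continuous_intros conth)
      ultimately show ?thesis by (simp add: dist_norm)
    qed
    then show "dist (T v) (T w) \<le> 1/2 * dist v w" by (intro dist_bound) simp
  qed auto
  then obtain v where v: "T v = v" by blast
  define x where "x t = x0 + exp (2 * K * t) *\<^sub>R v t" for t
  have x: "x t = x0 + integral {0..t} (\<lambda>s. F (x s))" if "t \<ge> 0" for t
  proof -
    have "v t = exp (- 2 * K * t) *\<^sub>R integral {0..t} (h v)"
      using fun_cong[OF T[of v], of t] that by (simp add: v P_def)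
    then show ?thesis by (simp add: x_def h_def[abs_def] exp_minus)
  qed
  have contx: "continuous_on S (\<lambda>s. F (x s))" for S
    using conth[of S v] by (simp add: h_def[abs_def] x_def)
  have deriv: "(x has_vector_derivative F (x t)) (at t within {0..})" if "t \<ge> 0" for t
  proof -
    \<comment> \<open>The interval reaches to \<open>t + 1\<close> so that \<open>t\<close> is not
      its right end; near \<open>t\<close> it then agrees with the half-line.\<close>
    have "((\<lambda>t. integral {0..t} (\<lambda>s. F (x s))) has_vector_derivative F (x t)) (at t within {0..t+1})"
      using that by (intro integral_has_vector_derivative contx) auto
    then have "((\<lambda>t. x0 + integral {0..t} (\<lambda>s. F (x s))) has_vector_derivative F (x t)) (at t within {0..t+1})"
      by (auto intro!: derivative_eq_intros)
    moreover have "at t within {0..t+1} = at t within {0..}"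
      by (rule at_within_nhd[of _ "{..<t+1}"]) auto
    ultimately have "((\<lambda>t. x0 + integral {0..t} (\<lambda>s. F (x s))) has_vector_derivative F (x t)) (at t within {0..})"
      by simp
    then show ?thesis
      by (rule has_vector_derivative_transform[rotated 2]) (use that x in auto)
  qed
  have "x 0 = x0" using x[of 0] by simp
  then show ?thesis using deriv that by blast
qed

section \<open>Uniqueness of collision-free solutions\<close>

lemma gronwall_unique:
  fixes x y x' y' :: "real \<Rightarrow> 'a::real_inner"
  assumes "T \<ge> 0"
    and x: "\<And>t. t \<in> {0..T} \<Longrightarrow> (x has_vector_derivative x' t) (at t within {0..T})"
    and y: "\<And>t. t \<in> {0..T} \<Longrightarrow> (y has_vector_derivative y' t) (at t within {0..T})"
    and lip: "\<And>t. t \<in> {0..T} \<Longrightarrow> norm (x' t - y' t) \<le> L * norm (x t - y t)"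
    and "x 0 = y 0"
  shows "x T = y T"
proof -
  define z where "z t = x t - y t" for t
  define z' where "z' t = x' t - y' t" for t
  \<comment> \<open>The weighted squared distance is nonincreasing, because
    \<open>z t \<bullet> z t\<close> grows at most at the relative rate \<open>2 * L\<close>. The
    minus sign turns this into \<open>D 0 \<le> D T\<close>; since \<open>D 0 = 0\<close> and
    \<open>D\<close> is never positive, \<open>D T = 0\<close>.\<close>
  define D where "D t = - exp (- 2 * L * t) * (z t \<bullet> z t)" for t
  have z: "(z has_vector_derivative z' t) (at t within {0..T})" if "t \<in> {0..T}" for t
    unfolding z_def[abs_def] z'_def by (intro has_vector_derivative_diff x y that)
  have D: "(D has_vector_derivative 2 * exp (- 2 * L * t) * (L * (z t \<bullet> z t) - z t \<bullet> z' t))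
      (at t within {0..T})" if "t \<in> {0..T}" for t
  proof -
    have "((\<lambda>t. - exp (- 2 * L * t)) has_real_derivative 2 * L * exp (- 2 * L * t)) (at t within {0..T})"
      by (auto intro!: derivative_eq_intros)
    from has_vector_derivative_mult[OF this[unfolded has_real_derivative_iff_has_vector_derivative]
        bounded_bilinear.has_vector_derivative[OF bounded_bilinear_inner z[OF that] z[OF that]]]
    show ?thesis
      unfolding D_def[abs_def]
      by (rule has_vector_derivative_eq_rhs) (auto simp: algebra_simps inner_commute)
  qed
  have "D 0 \<le> D T"
  proof (rule DERIV_nonneg_imp_increasing_open[where f = D])
    show "continuous_on {0..T} D"
      unfolding continuous_on_eq_continuous_within
      by (intro ballI has_vector_derivative_continuous[OF D])
    fix t assume t: "0 < t" "t < T"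
    have "z t \<bullet> z' t \<le> norm (z t) * norm (z' t)" by (rule norm_cauchy_schwarz)
    also have "\<dots> \<le> norm (z t) * (L * norm (z t))"
      using lip[of t] t by (intro mult_left_mono) (auto simp: z_def z'_def)
    also have "\<dots> = L * (z t \<bullet> z t)"
      by (simp add: power2_norm_eq_inner[symmetric] power2_eq_square)
    finally have "0 \<le> 2 * exp (- 2 * L * t) * (L * (z t \<bullet> z t) - z t \<bullet> z' t)" by simp
    moreover have "DERIV D t :> 2 * exp (- 2 * L * t) * (L * (z t \<bullet> z t) - z t \<bullet> z' t)"
      using D[of t] t by (simp add: at_within_Icc_at has_real_derivative_iff_has_vector_derivative)
    ultimately show "\<exists>d. DERIV D t :> d \<and> d \<ge> 0" by blast
  qed fact
  then have "z T \<bullet> z T \<le> 0"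
    using \<open>x 0 = y 0\<close> by (simp add: D_def z_def mult_le_0_iff)
  then have "z T = 0" by (metis inner_gt_zero_iff not_less)
  then show ?thesis by (simp add: z_def)
qed

text \<open>Inversion in the unit sphere distorts distances by an explicit factor: squared, both
  sides expand to the same expression in \<open>p\<close>, \<open>q\<close> and
  \<open>v \<bullet> w\<close>. This makes the pair interaction Lipschitz away from
  collisions.\<close>

lemma norm_inversion_diff:
  fixes v w :: "'a::real_inner"
  assumes "v \<noteq> 0" "w \<noteq> 0"
  shows "norm ((1 / (norm v)\<^sup>2) *\<^sub>R v - (1 / (norm w)\<^sup>2) *\<^sub>R w) = norm (v - w) / (norm v * norm w)"
proof (rule power2_eq_imp_eq)
  define p q where "p = v \<bullet> v" and "q = w \<bullet> w"
  have pq: "p \<noteq> 0" "q \<noteq> 0" using assms by (auto simp: p_def q_def)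
  show "(norm ((1 / (norm v)\<^sup>2) *\<^sub>R v - (1 / (norm w)\<^sup>2) *\<^sub>R w))\<^sup>2
      = (norm (v - w) / (norm v * norm w))\<^sup>2"
    unfolding power_divide power_mult_distrib power2_norm_eq_inner inner_diff inner_scaleR_left inner_scaleR_right
      p_def[symmetric] q_def[symmetric] inner_commute[of w v]
    using pq by (simp add: field_simps power2_eq_square)
qed auto

lemma has_vector_derivative_vec_componentwise:
  fixes f :: "real \<Rightarrow> 'a::real_normed_vector ^ 'n"
  assumes "\<And>j. ((\<lambda>s. f s $ j) has_vector_derivative f' $ j) F"
  shows "(f has_vector_derivative f') F"
  unfolding has_vector_derivative_def has_derivative_def
proof (intro conjI vec_tendstoI bounded_linear_scaleR_left)
  fix j
  show "((\<lambda>y. ((f y - f (Lim F (\<lambda>x. x)) - (y - Lim F (\<lambda>x. x)) *\<^sub>R f') /\<^sub>R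
      norm (y - Lim F (\<lambda>x. x))) $ j) \<longlongrightarrow> 0 $ j) F"
    using assms[of j] by (simp add: has_vector_derivative_def has_derivative_def)
qed

text \<open>The velocity field is singular at collisions, but along two given solutions all mutual
  distances are continuous and positive on the compact interval \<open>{0..T}\<close>, so one
  Lipschitz constant serves there and Gronwall applies.\<close>

lemma solution_unique:
  fixes X Y :: "real \<Rightarrow> real ^ 2 ^ 'n"
  assumes X: "is_solution m X" and Y: "is_solution m Y" and "X 0 = Y 0" and "T \<ge> 0"
  shows "X T = Y T"
proof -
  define V where "V X = (\<chi> j. velocity m X j)" for X :: "real ^ 2 ^ 'n"
  \<comment> \<open>A difference of two columns changes by at most \<open>2 * norm (X - Y)\<close>,
    and inversion divides this by the two distances.\<close>
  define c where "c X Y = (\<Sum>j\<in>UNIV. \<bar>2 * m j\<bar> * (\<Sum>k\<in>UNIV - {j}. \<bar>m k\<bar> *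
      (2 / (norm (X $ j - X $ k) * norm (Y $ j - Y $ k)))))" for X Y :: "real ^ 2 ^ 'n"
  have V_deriv: "(Z has_vector_derivative V (Z t)) (at t within {0..T})"
    if "is_solution m Z" "t \<in> {0..T}" for Z t
  proof (rule has_vector_derivative_vec_componentwise)
    fix j
    have "((\<lambda>s. Z s $ j) has_vector_derivative V (Z t) $ j) (at t within {0..})"
      using that by (simp add: is_solution_def V_def)
    then show "((\<lambda>s. Z s $ j) has_vector_derivative V (Z t) $ j) (at t within {0..T})"
      by (rule has_vector_derivative_within_subset) auto
  qed
  have V_diff: "norm (V X - V Y) \<le> c X Y * norm (X - Y)"
    if X: "X \<in> distinct_configs" and Y: "Y \<in> distinct_configs" for X Y
  proof -
    have pair: "norm (m k *\<^sub>R ((1 / (norm (X $ j - X $ k))\<^sup>2) *\<^sub>R (X $ j - X $ k)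
            - (1 / (norm (Y $ j - Y $ k))\<^sup>2) *\<^sub>R (Y $ j - Y $ k)))
        \<le> \<bar>m k\<bar> * (2 / (norm (X $ j - X $ k) * norm (Y $ j - Y $ k))) * norm (X - Y)"
      if "j \<noteq> k" for j k
    proof -
      have "X $ j - X $ k \<noteq> 0" "Y $ j - Y $ k \<noteq> 0"
        using X Y that by (auto simp: distinct_configs_def)
      moreover have "norm ((X $ j - X $ k) - (Y $ j - Y $ k)) \<le> 2 * norm (X - Y)"
      proof -
        have "(X $ j - X $ k) - (Y $ j - Y $ k) = (X - Y) $ j - (X - Y) $ k" by simp
        also have "norm \<dots> \<le> norm ((X - Y) $ j) + norm ((X - Y) $ k)"
          by (rule norm_triangle_ineq4)
        also have "\<dots> \<le> 2 * norm (X - Y)"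
          using Finite_Cartesian_Product.norm_nth_le[of "X - Y" j]
            Finite_Cartesian_Product.norm_nth_le[of "X - Y" k] by linarith
        finally show ?thesis .
      qed
      ultimately show ?thesis
        unfolding norm_scaleR by (subst norm_inversion_diff)
          (auto simp: mult.assoc intro!: mult_left_mono divide_right_mono)
    qed
    have "norm (V X - V Y) \<le> (\<Sum>j\<in>UNIV. norm ((V X - V Y) $ j))"
      unfolding norm_vec_def by (rule L2_set_le_sum) simp
    also have "\<dots> \<le> (\<Sum>j\<in>UNIV. \<bar>2 * m j\<bar> * (\<Sum>k\<in>UNIV - {j}. \<bar>m k\<bar> *
      (2 / (norm (X $ j - X $ k) * norm (Y $ j - Y $ k))) * norm (X - Y)))"
    proof (rule sum_mono)
      fix j
      have "(V X - V Y) $ j = (2 * m j) *\<^sub>R (\<Sum>k\<in>UNIV - {j}.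
          m k *\<^sub>R ((1 / (norm (X $ j - X $ k))\<^sup>2) *\<^sub>R (X $ j - X $ k)
            - (1 / (norm (Y $ j - Y $ k))\<^sup>2) *\<^sub>R (Y $ j - Y $ k)))"
        by (simp add: V_def velocity_def scaleR_diff_right sum_subtractf)
      also have "norm \<dots> \<le> \<bar>2 * m j\<bar> * (\<Sum>k\<in>UNIV - {j}. \<bar>m k\<bar> *
          (2 / (norm (X $ j - X $ k) * norm (Y $ j - Y $ k))) * norm (X - Y))"
        unfolding norm_scaleR real_norm_def
        by (intro mult_left_mono sum_norm_le[OF order_trans[OF order_refl pair]]) auto
      finally show "norm ((V X - V Y) $ j) \<le> \<bar>2 * m j\<bar> * (\<Sum>k\<in>UNIV - {j}. \<bar>m k\<bar> *
          (2 / (norm (X $ j - X $ k) * norm (Y $ j - Y $ k))) * norm (X - Y))" .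
    qed
    also have "\<dots> = c X Y * norm (X - Y)"
      by (simp add: c_def sum_distrib_right mult.assoc)
    finally show ?thesis .
  qed
  have cont: "continuous_on {0..T} (\<lambda>t. Z t $ j)" if "is_solution m Z" for Z j
    unfolding continuous_on_eq_continuous_within
    using has_vector_derivative_continuous[OF V_deriv[OF that]]
    by (auto intro: continuous_component)
  have distinct: "Z t $ j \<noteq> Z t $ k" if "is_solution m Z" "t \<in> {0..T}" "k \<in> UNIV - {j}" for Z t j k
    using that unfolding is_solution_def distinct_configs_def by auto
  have "continuous_on {0..T} (\<lambda>t. c (X t) (Y t))"
    unfolding c_def
    by (intro continuous_intros cont X Y) (simp add: distinct[OF X] distinct[OF Y])
  then obtain L where "\<And>t. t \<in> {0..T} \<Longrightarrow> c (X t) (Y t) \<le> L"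
    using continuous_attains_sup[of "{0..T}" "\<lambda>t. c (X t) (Y t)"] \<open>T \<ge> 0\<close> by fastforce
  then have lip: "norm (V (X t) - V (Y t)) \<le> L * norm (X t - Y t)" if "t \<in> {0..T}" for t
    using V_diff[of "X t" "Y t"] X Y that
    by (meson is_solution_def atLeastAtMost_iff mult_right_mono norm_ge_zero order_trans)
  show ?thesis
    by (rule gronwall_unique[where x' = "\<lambda>t. V (X t)" and y' = "\<lambda>t. V (Y t)"])
       (use lip V_deriv X Y \<open>X 0 = Y 0\<close> \<open>T \<ge> 0\<close> in blast)+
qed

section \<open>The reduced system for the two Fourier coefficients\<close>

definition \<omega> :: complex where "\<omega> = cis (2 * pi / 3)"

lemma omega_eq: "\<omega> = Complex (- 1 / 2) (sqrt 3 / 2)"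
  by (simp add: \<omega>_def complex_eq_iff cos_120 sin_120)

lemma omega_square: "\<omega>\<^sup>2 = - 1 - \<omega>"
  by (simp add: omega_eq complex_eq_iff power2_eq_square)

text \<open>As rewrite rules these bring every polynomial in \<open>\<omega>\<close> to degree at
  most one, so that algebraic identities below reduce to normalization. The second form catches
  right-nested products.\<close>

lemma omega_mult: "\<omega> * \<omega> = - 1 - \<omega>" "\<omega> * (\<omega> * z) = - z - \<omega> * z"
proof -
  show "\<omega> * \<omega> = - 1 - \<omega>" using omega_square by (simp add: power2_eq_square)
  then show "\<omega> * (\<omega> * z) = - z - \<omega> * z"
    by (metis mult.assoc left_diff_distrib mult_minus1)
qed

lemma norm_omega [simp]: "cmod \<omega> = 1"
  by (simp add: \<omega>_def)

text \<open>The partial fraction expansions of \<open>2 * a\<^sup>2 / (a ^ 3 - b ^ 3)\<close> and \<open>- 2 * b\<^sup>2 / (a ^ 3 - b ^ 3)\<close>, conjugated.\<close>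

definition flow_a :: "complex \<Rightarrow> complex \<Rightarrow> complex" where
  "flow_a a b = (2 / 3) *\<^sub>R (cnj (1 / (a - b)) + cnj (1 / (a - \<omega> * b)) + cnj (1 / (a - \<omega>\<^sup>2 * b)))"

definition flow_b :: "complex \<Rightarrow> complex \<Rightarrow> complex" where
  "flow_b a b = - (2 / 3) *\<^sub>R (cnj (1 / (a - b)) + cnj (\<omega> / (a - \<omega> * b)) + cnj (\<omega>\<^sup>2 / (a - \<omega>\<^sup>2 * b)))"

lemma cube_root_factors_nonzero:
  assumes "cmod b < cmod a"
  shows "a - b \<noteq> 0" "a - \<omega> * b \<noteq> 0" "a - \<omega>\<^sup>2 * b \<noteq> 0"
  using assms by (auto simp: norm_mult norm_power dest: arg_cong[where f = cmod])

lemma flow_b_eq: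
  assumes "cmod b < cmod a"
  shows "flow_b a b = - 2 * cnj (b\<^sup>2 / (a ^ 3 - b ^ 3))"
proof -
  note nz = cube_root_factors_nonzero[OF assms]
  have "a ^ 3 - b ^ 3 = (a - b) * (a - \<omega> * b) * (a - \<omega>\<^sup>2 * b)"
    by (simp add: algebra_simps power2_eq_square power3_eq_cube omega_mult)
  \<comment> \<open>This is the numerator over the common denominator: the weights 1,
    \<open>\<omega>\<close>, \<open>\<omega>\<^sup>2\<close> cancel the terms in
    \<open>a\<^sup>2\<close> and \<open>a * b\<close>.\<close>
  moreover have "1 * ((a - \<omega> * b) * (a - \<omega>\<^sup>2 * b)) + \<omega> * ((a - b) * (a - \<omega>\<^sup>2 * b)) + \<omega>\<^sup>2 * ((a - b) * (a - \<omega> * b)) = 3 * b\<^sup>2"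
    by (simp add: algebra_simps power2_eq_square power3_eq_cube omega_mult)
  ultimately have "1 / (a - b) + \<omega> / (a - \<omega> * b) + \<omega>\<^sup>2 / (a - \<omega>\<^sup>2 * b) = 3 * b\<^sup>2 / (a ^ 3 - b ^ 3)"
    using nz by (simp add: divide_simps) (simp add: algebra_simps)
  then have "flow_b a b = - (2 / 3) *\<^sub>R cnj (3 * b\<^sup>2 / (a ^ 3 - b ^ 3))"
    unfolding flow_b_def by (metis complex_cnj_add)
  then show ?thesis by (simp add: scaleR_conv_of_real)
qed

text \<open>In modulus, \<open>b ^ 3\<close> is at most an eighth of \<open>a ^ 3\<close>, so the
  denominator in \<open>flow_b_eq\<close> keeps at least half of it. The cubic decay in
  \<open>a\<close> is what makes the drift of \<open>b\<close> integrable in time.\<close>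

lemma norm_flow_b_le:
  assumes "cmod b \<le> cmod a / 2" "a \<noteq> 0"
  shows "cmod (flow_b a b) \<le> 4 * (cmod b)\<^sup>2 / cmod a ^ 3"
proof -
  have lt: "cmod b < cmod a" using assms by (smt (verit) zero_less_norm_iff field_sum_of_halves)
  have "cmod b ^ 3 \<le> (cmod a / 2) ^ 3" using assms by (intro power_mono) auto
  also have "\<dots> \<le> cmod a ^ 3 / 2" by (simp add: power_divide)
  finally have "cmod a ^ 3 / 2 \<le> cmod (a ^ 3) - cmod (b ^ 3)" by (simp add: norm_power)
  also have "\<dots> \<le> cmod (a ^ 3 - b ^ 3)" by (rule norm_triangle_ineq2)
  finally have le: "cmod a ^ 3 / 2 \<le> cmod (a ^ 3 - b ^ 3)" .
  have "cmod (flow_b a b) = 2 * (cmod b)\<^sup>2 / cmod (a ^ 3 - b ^ 3)"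
    unfolding flow_b_eq[OF lt] by (simp only: norm_mult complex_mod_cnj norm_divide norm_power) simp
  also have "\<dots> \<le> 2 * (cmod b)\<^sup>2 / (cmod a ^ 3 / 2)"
    using le assms by (intro divide_left_mono) (auto intro!: mult_pos_pos elim!: less_le_trans[rotated])
  finally show ?thesis by simp
qed

text \<open>The conjugate reciprocal is inversion in the unit circle, for
  \<open>w \<noteq> 0\<close> a positive multiple of \<open>w\<close>. This gives the signs of inner
  products with the poles and links them to the pair interaction. At \<open>w = 0\<close> both sides
  are 0.\<close>

lemma cnj_inverse_eq_scaleR: "cnj (1 / w) = (1 / (cmod w)\<^sup>2) *\<^sub>R w"
  by (cases "w = 0") (simp_all add: divide_simps complex_norm_square scaleR_conv_of_real mult.commute del: of_real_power flip: of_real_power)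

text \<open>Each pole contributes a nonnegative multiple of \<open>a - \<zeta> * b\<close>, whose
  component along \<open>u\<close> is nonnegative because \<open>u \<bullet> (\<zeta> * b)\<close>
  is at most \<open>cmod b\<close>.\<close>

lemma flow_a_inner_nonneg:
  assumes "norm u = 1" "cmod b \<le> u \<bullet> a"
  shows "0 \<le> u \<bullet> flow_a a b"
proof -
  have "0 \<le> u \<bullet> cnj (1 / (a - \<zeta> * b))" if "cmod \<zeta> = 1" for \<zeta>
  proof -
    have "u \<bullet> (\<zeta> * b) \<le> cmod b"
      using norm_cauchy_schwarz[of u "\<zeta> * b"] assms that by (simp add: norm_mult)
    then show ?thesis
      using assms unfolding cnj_inverse_eq_scaleR by (simp add: inner_diff_right)
  qed
  from this[of 1] this[of \<omega>] this[of "\<omega>\<^sup>2"] show ?thesis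
    by (simp add: flow_a_def inner_add_right norm_power)
qed

text \<open>Each pole contributes at least 1/2, since \<open>w = a - \<zeta> * b\<close> is no
  farther from \<open>a\<close> than the origin is; three of them times 2/3 give 1.\<close>

lemma flow_a_inner_self_ge:
  assumes "cmod b < cmod a"
  shows "1 \<le> a \<bullet> flow_a a b"
proof -
  have "1 / 2 \<le> a \<bullet> cnj (1 / (a - \<zeta> * b))" if "cmod \<zeta> = 1" for \<zeta>
  proof -
    define w where "w = a - \<zeta> * b"
    have "w \<noteq> 0" using assms that by (auto simp: w_def norm_mult dest: arg_cong[where f = cmod])
    have "(cmod (a - w))\<^sup>2 \<le> (cmod a)\<^sup>2"
      using assms that by (intro power_mono) (auto simp: w_def norm_mult)
    moreover have "2 * (a \<bullet> w) = (cmod a)\<^sup>2 + (cmod w)\<^sup>2 - (cmod (a - w))\<^sup>2"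
      by (simp add: power2_norm_eq_inner inner_diff inner_commute)
    ultimately have "(cmod w)\<^sup>2 \<le> 2 * (a \<bullet> w)" by simp
    then show ?thesis
      using \<open>w \<noteq> 0\<close> unfolding w_def[symmetric] cnj_inverse_eq_scaleR
      by (simp add: field_simps)
  qed
  from this[of 1] this[of \<omega>] this[of "\<omega>\<^sup>2"] show ?thesis
    by (simp add: flow_a_def inner_add_right norm_power)
qed

section \<open>Truncation and global solution of the reduced system\<close>

lemma nonneg_derivative_imp_ge_initial:
  fixes f :: "real \<Rightarrow> real"
  assumes f: "\<And>t. t \<ge> 0 \<Longrightarrow> (f has_vector_derivative f' t) (at t within {0..})"
    and "\<And>t. t \<ge> 0 \<Longrightarrow> 0 \<le> f' t" and "t \<ge> 0"
  shows "f 0 \<le> f t"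
proof (rule DERIV_nonneg_imp_increasing_open[where f = f])
  have "continuous_on {0..} f"
    unfolding continuous_on_eq_continuous_within
    using has_vector_derivative_continuous[OF f] by auto
  then show "continuous_on {0..t} f"
    by (rule continuous_on_subset) auto
  fix s assume s: "0 < s" "s < t"
  then have "at s within {0..} = at s" by (intro at_within_interior) auto
  then show "\<exists>d. DERIV f s :> d \<and> 0 \<le> d"
    using f[of s] assms(2)[of s] s by (auto simp: has_real_derivative_iff_has_vector_derivative)
qed fact

text \<open>Projections onto closed convex sets do not increase distances, and the reciprocal is
  Lipschitz where the modulus stays above \<open>\<kappa>\<close>. The factor 2 comes from bounding
  both coordinate distances by the distance of the pairs.\<close>

lemma lipschitz_truncated_pole:
  assumes A: "closed A" "convex A" "A \<noteq> {}" and B: "closed B" "convex B" "B \<noteq> {}"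
    and "\<kappa> > 0" and dist: "\<And>a b. a \<in> A \<Longrightarrow> b \<in> B \<Longrightarrow> \<kappa> \<le> cmod (a - \<zeta> * b)"
    and "cmod \<zeta> = 1" "cmod \<eta> = 1"
  shows "(2 / \<kappa>\<^sup>2)-lipschitz_on UNIV
    (\<lambda>p. cnj (\<eta> / (closest_point A (fst p) - \<zeta> * closest_point B (snd p))))"
proof (rule lipschitz_onI)
  fix p q :: "complex \<times> complex"
  define w where "w p = closest_point A (fst p) - \<zeta> * closest_point B (snd p)" for p
  have w: "\<kappa> \<le> cmod (w p)" for p
    unfolding w_def using A B by (intro dist closest_point_in_set) auto
  then have nz: "w p \<noteq> 0" for p using \<open>\<kappa> > 0\<close> by (metis norm_zero not_le)
  have "w p - w q = (closest_point A (fst p) - closest_point A (fst q))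
      - \<zeta> * (closest_point B (snd p) - closest_point B (snd q))"
    by (simp add: w_def algebra_simps)
  also have "cmod \<dots> \<le> dist (closest_point A (fst p)) (closest_point A (fst q))
      + dist (closest_point B (snd p)) (closest_point B (snd q))"
    using norm_triangle_ineq4 by (rule order_trans) (simp add: norm_mult assms dist_norm)
  also have "\<dots> \<le> dist (fst p) (fst q) + dist (snd p) (snd q)"
    using A B by (intro add_mono closest_point_lipschitz)
  also have "\<dots> \<le> 2 * dist p q"
    using dist_fst_le[of p q] dist_snd_le[of p q] by simp
  finally have diff: "cmod (w p - w q) \<le> 2 * dist p q" .
  have "\<eta> / w p - \<eta> / w q = \<eta> * (w q - w p) / (w p * w q)"
    using nz by (simp add: field_simps)
  then have "dist (cnj (\<eta> / w p)) (cnj (\<eta> / w q)) = cmod (w p - w q) / (cmod (w p) * cmod (w q))"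
    by (simp add: dist_norm norm_mult norm_divide assms norm_minus_commute flip: complex_cnj_diff del: complex_cnj_divide)
  also have "\<dots> \<le> (2 * dist p q) / (\<kappa> * \<kappa>)"
    using w \<open>\<kappa> > 0\<close> diff by (intro frac_le mult_mono) auto
  finally show "dist (cnj (\<eta> / (closest_point A (fst p) - \<zeta> * closest_point B (snd p))))
      (cnj (\<eta> / (closest_point A (fst q) - \<zeta> * closest_point B (snd q)))) \<le> 2 / \<kappa>\<^sup>2 * dist p q"
    by (simp add: w_def power2_eq_square)
qed simp

lemma lipschitz_truncated_flow:
  assumes A: "closed A" "convex A" "A \<noteq> {}" and B: "closed B" "convex B" "B \<noteq> {}"
    and "\<kappa> > 0" and dist: "\<And>a b. a \<in> A \<Longrightarrow> b \<in> B \<Longrightarrow> \<kappa> \<le> cmod a - cmod b"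
  obtains L where "L-lipschitz_on UNIV (\<lambda>p.
    (flow_a (closest_point A (fst p)) (closest_point B (snd p)),
     flow_b (closest_point A (fst p)) (closest_point B (snd p))))"
proof -
  have pole: "(2 / \<kappa>\<^sup>2)-lipschitz_on UNIV
      (\<lambda>p. cnj (\<eta> / (closest_point A (fst p) - \<zeta> * closest_point B (snd p))))"
    if "cmod \<zeta> = 1" "cmod \<eta> = 1" for \<zeta> \<eta>
  proof (rule lipschitz_truncated_pole[OF A B \<open>\<kappa> > 0\<close> _ that])
    fix a b assume "a \<in> A" "b \<in> B"
    then have "\<kappa> \<le> cmod a - cmod (\<zeta> * b)" using dist that by (simp add: norm_mult)
    also have "\<dots> \<le> cmod (a - \<zeta> * b)" by (rule norm_triangle_ineq2)
    finally show "\<kappa> \<le> cmod (a - \<zeta> * b)" .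
  qed
  have poles:
    "(2 / \<kappa>\<^sup>2)-lipschitz_on UNIV (\<lambda>p. cnj (1 / (closest_point A (fst p) - closest_point B (snd p))))"
    "(2 / \<kappa>\<^sup>2)-lipschitz_on UNIV (\<lambda>p. cnj (1 / (closest_point A (fst p) - \<omega> * closest_point B (snd p))))"
    "(2 / \<kappa>\<^sup>2)-lipschitz_on UNIV (\<lambda>p. cnj (1 / (closest_point A (fst p) - \<omega>\<^sup>2 * closest_point B (snd p))))"
    "(2 / \<kappa>\<^sup>2)-lipschitz_on UNIV (\<lambda>p. cnj (\<omega> / (closest_point A (fst p) - \<omega> * closest_point B (snd p))))"
    "(2 / \<kappa>\<^sup>2)-lipschitz_on UNIV (\<lambda>p. cnj (\<omega>\<^sup>2 / (closest_point A (fst p) - \<omega>\<^sup>2 * closest_point B (snd p))))"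
    using pole[of 1 1] pole[of \<omega> 1] pole[of "\<omega>\<^sup>2" 1] pole[of \<omega> \<omega>] pole[of "\<omega>\<^sup>2" "\<omega>\<^sup>2"]
    by (simp_all add: norm_power)
  show ?thesis
    \<comment> \<open>The constant \<open>L\<close> is never written down; unification assembles it
      from the constants of the poles.\<close>
    by (rule that, unfold flow_a_def flow_b_def) (rule lipschitz_on_Pair lipschitz_on_cmult lipschitz_on_add poles)+
qed

text \<open>The constants close the argument: the drift of \<open>b\<close> is at most
  \<open>4 * \<rho>\<^sup>2 / cmod a\<^sub>0\<close>, hence at most \<open>\<rho> / 2\<close> as
  \<open>\<rho> \<le> cmod a\<^sub>0 / 8\<close>, and the initial value takes the other half of
  \<open>\<rho>\<close>.\<close>

lemma reduced_flow_global_solution: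
  fixes a\<^sub>0 b\<^sub>0 :: complex
  assumes "a\<^sub>0 \<noteq> 0" "\<rho> > 0" "\<rho> \<le> cmod a\<^sub>0 / 8" "cmod b\<^sub>0 \<le> \<rho> / 2"
  obtains a b where "a 0 = a\<^sub>0" "b 0 = b\<^sub>0"
    "\<And>t. t \<ge> 0 \<Longrightarrow> (a has_vector_derivative flow_a (a t) (b t)) (at t within {0..})"
    "\<And>t. t \<ge> 0 \<Longrightarrow> (b has_vector_derivative flow_b (a t) (b t)) (at t within {0..})"
    "\<And>t. t \<ge> 0 \<Longrightarrow> cmod (b t) \<le> \<rho>"
    "\<And>t. t \<ge> 0 \<Longrightarrow> cmod a\<^sub>0 \<le> cmod (a t)"
proof -
  define c u where "c = cmod a\<^sub>0" and "u = sgn a\<^sub>0"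
  \<comment> \<open>The half-plane touches the circle of radius \<open>c\<close> at
    \<open>a\<^sub>0\<close>, so it keeps distance \<open>c\<close> from the origin. Unlike the
    exterior of the disc it is convex, which the projection needs.\<close>
  define A B where "A = {w. u \<bullet> w \<ge> c}" and "B = cball (0::complex) \<rho>"
  have c: "c > 0" "\<rho> \<le> c / 8" and u: "norm u = 1" using assms by (auto simp: c_def u_def norm_sgn)
  have a\<^sub>0: "u \<bullet> a\<^sub>0 = c"
    using assms by (simp add: u_def c_def sgn_div_norm power2_norm_eq_inner[symmetric] power2_eq_square)
  have A: "closed A" "convex A" "A \<noteq> {}"
    using a\<^sub>0 by (auto simp: A_def closed_halfspace_ge convex_halfspace_ge)
  have B: "closed B" "convex B" "B \<noteq> {}" using assms by (auto simp: B_def)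
  have normA: "c \<le> cmod w" if "w \<in> A" for w
    using that norm_cauchy_schwarz[of u w] u by (simp add: A_def)
  define pa pb where "pa = closest_point A" and "pb = closest_point B"
  have pa: "pa w \<in> A" and pb: "cmod (pb w) \<le> \<rho>" for w
    using closest_point_in_set[OF A(1,3)] closest_point_in_set[OF B(1,3)]
    by (auto simp: pa_def pb_def B_def)
  obtain L where L: "L-lipschitz_on UNIV (\<lambda>p. (flow_a (pa (fst p)) (pb (snd p)), flow_b (pa (fst p)) (pb (snd p))))"
  proof (rule lipschitz_truncated_flow[OF A B, of "c / 2"])
    fix a b assume "a \<in> A" "b \<in> B"
    then show "c / 2 \<le> cmod a - cmod b" using normA[of a] c by (simp add: B_def)
  qed (use c in \<open>auto simp: pa_def pb_def\<close>)
  from lipschitz_ode_global_solution[OF L, of "(a\<^sub>0, b\<^sub>0)"] obtain x where x: "x 0 = (a\<^sub>0, b\<^sub>0)"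
    "\<And>t. t \<ge> 0 \<Longrightarrow> (x has_vector_derivative
        (flow_a (pa (fst (x t))) (pb (snd (x t))), flow_b (pa (fst (x t))) (pb (snd (x t))))) (at t within {0..})"
    by auto
  define a b where "a t = fst (x t)" and "b t = snd (x t)" for t
  have init: "a 0 = a\<^sub>0" "b 0 = b\<^sub>0" using x(1) by (auto simp: a_def b_def)
  have da: "(a has_vector_derivative flow_a (pa (a t)) (pb (b t))) (at t within {0..})"
    and db: "(b has_vector_derivative flow_b (pa (a t)) (pb (b t))) (at t within {0..})" if "t \<ge> 0" for t
    using bounded_linear.has_vector_derivative[OF bounded_linear_fst x(2)[OF that]]
      bounded_linear.has_vector_derivative[OF bounded_linear_snd x(2)[OF that]]
    by (auto simp: a_def[abs_def] b_def[abs_def])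
  \<comment> \<open>No continuation argument is needed: the truncated arguments always lie in
    \<open>A\<close> and in the disc, so the sign of \<open>u \<bullet> flow_a\<close> is known for
    the truncated solution at all times.\<close>
  have a_in: "a t \<in> A" if "t \<ge> 0" for t
  proof -
    have "u \<bullet> a 0 \<le> u \<bullet> a t"
    proof (rule nonneg_derivative_imp_ge_initial[where f = "\<lambda>t. u \<bullet> a t"])
      fix s :: real assume "s \<ge> 0"
      then show "((\<lambda>t. u \<bullet> a t) has_vector_derivative u \<bullet> flow_a (pa (a s)) (pb (b s))) (at s within {0..})"
        by (intro bounded_linear.has_vector_derivative[OF bounded_linear_inner_right] da)
      have "cmod (pb (b s)) \<le> u \<bullet> pa (a s)"
        using pb[of "b s"] pa[of "a s"] c by (simp add: A_def)
      then show "0 \<le> u \<bullet> flow_a (pa (a s)) (pb (b s))" by (rule flow_a_inner_nonneg[OF u])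
    qed fact
    then show ?thesis using init a\<^sub>0 by (simp add: A_def)
  qed
  then have pa_a: "pa (a t) = a t" if "t \<ge> 0" for t
    using that by (simp add: pa_def closest_point_self)
  have a_ge: "c\<^sup>2 + 2 * t \<le> (cmod (a t))\<^sup>2" if "t \<ge> 0" for t
  proof -
    have "a 0 \<bullet> a 0 - 2 * 0 \<le> a t \<bullet> a t - 2 * t"
    proof (rule nonneg_derivative_imp_ge_initial[where f = "\<lambda>t. a t \<bullet> a t - 2 * t"])
      fix s :: real assume s: "s \<ge> 0"
      have "((\<lambda>t. 2 * t) has_vector_derivative 2) (at s within {0..})"
        by (auto intro!: derivative_eq_intros simp flip: has_real_derivative_iff_has_vector_derivative)
      from has_vector_derivative_diff[OF bounded_bilinear.has_vector_derivative[OF bounded_bilinear_inner da[OF s] da[OF s]] this]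
      show "((\<lambda>t. a t \<bullet> a t - 2 * t) has_vector_derivative
          2 * (a s \<bullet> flow_a (a s) (pb (b s))) - 2) (at s within {0..})"
        by (simp add: inner_commute pa_a[OF s])
      have "cmod (pb (b s)) < cmod (a s)"
        using pb[of "b s"] normA[OF a_in[OF s]] c by simp
      then show "0 \<le> 2 * (a s \<bullet> flow_a (a s) (pb (b s))) - 2"
        using flow_a_inner_self_ge by fastforce
    qed fact
    then show ?thesis by (simp add: init c_def power2_norm_eq_inner)
  qed
  have b_le: "cmod (b t - b 0) \<le> \<rho> / 2" if "t \<ge> 0" for t
  proof (cases "t = 0")
    case False
    \<comment> \<open>\<open>\<phi>\<close> is an antiderivative of the bound
      \<open>4 * \<rho>\<^sup>2 / sqrt (c\<^sup>2 + 2 * s) ^ 3\<close> on the speed of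
      \<open>b\<close>; it increases to 0, so its total increase is
      \<open>- \<phi> 0\<close>.\<close>
    define \<phi> where "\<phi> s = - 4 * \<rho>\<^sup>2 / sqrt (c\<^sup>2 + 2 * s)" for s
    have pos: "c\<^sup>2 + 2 * s > 0" if "s \<ge> 0" for s using c that by (simp add: add_pos_nonneg)
    have "norm (b t - b 0) \<le> \<phi> t - \<phi> 0"
    proof (rule differentiable_bound_general)
      show "0 < t" using that False by simp
      have "continuous_on {0..} b"
        unfolding continuous_on_eq_continuous_within
        using has_vector_derivative_continuous[OF db] by auto
      then show "continuous_on {0..t} b" by (rule continuous_on_subset) auto
      show "continuous_on {0..t} \<phi>"
        unfolding \<phi>_def using pos by (intro continuous_intros) force
      fix s assume s: "0 < s" "s < t"
      then have "at s within {0..} = at s" by (intro at_within_interior) auto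
      then show "(b has_vector_derivative flow_b (a s) (pb (b s))) (at s)"
        using db[of s] pa_a[of s] s by simp
      show "(\<phi> has_vector_derivative 4 * \<rho>\<^sup>2 / sqrt (c\<^sup>2 + 2 * s) ^ 3) (at s)"
        unfolding \<phi>_def has_real_derivative_iff_has_vector_derivative[symmetric]
        using pos[of s] s
        by (auto intro!: derivative_eq_intros simp: field_simps power3_eq_cube)
      have as: "c \<le> cmod (a s)" using normA[OF a_in] s by simp
      have "sqrt (c\<^sup>2 + 2 * s) \<le> cmod (a s)" using a_ge[of s] s by (intro real_le_lsqrt) auto
      then have "sqrt (c\<^sup>2 + 2 * s) ^ 3 \<le> cmod (a s) ^ 3"
        using pos[of s] s by (intro power_mono) auto
      moreover have "norm (flow_b (a s) (pb (b s))) \<le> 4 * (cmod (pb (b s)))\<^sup>2 / cmod (a s) ^ 3"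
        using as c pb[of "b s"] by (intro norm_flow_b_le) auto
      moreover have "(cmod (pb (b s)))\<^sup>2 \<le> \<rho>\<^sup>2" using pb[of "b s"] by (intro power_mono) auto
      ultimately show "norm (flow_b (a s) (pb (b s))) \<le> 4 * \<rho>\<^sup>2 / sqrt (c\<^sup>2 + 2 * s) ^ 3"
        using pos[of s] s by (elim order_trans) (intro frac_le, auto)
    qed
    also have "\<dots> \<le> - \<phi> 0" using pos[of t] that by (simp add: \<phi>_def)
    also have "\<dots> = 4 * \<rho> * (\<rho> / c)" using c by (simp add: \<phi>_def power2_eq_square)
    also have "\<dots> \<le> 4 * \<rho> * (1 / 8)"
      using c assms by (intro mult_left_mono) (auto simp: divide_simps)
    finally show ?thesis by simp
  qed (use assms in simp)
  have b_in: "cmod (b t) \<le> \<rho>" if "t \<ge> 0" for t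
    using b_le[OF that] assms(4) init norm_triangle_ineq[of "b 0" "b t - b 0"] by simp
  then have pb_b: "pb (b t) = b t" if "t \<ge> 0" for t
    using that by (simp add: pb_def B_def closest_point_self)
  show ?thesis
    using that[of a b] init da db pa_a pb_b b_in normA[OF a_in] by (simp add: c_def)
qed

section \<open>Triangles in Fourier coordinates\<close>

definition cvec :: "complex \<Rightarrow> real ^ 2" where "cvec z = vector [Re z, Im z]"

lemma cvec_nth [simp]: "cvec z $ 1 = Re z" "cvec z $ 2 = Im z"
  by (simp_all add: cvec_def)

lemma cvec_simps:
  "cvec (y + z) = cvec y + cvec z" "cvec (y - z) = cvec y - cvec z" "cvec (r *\<^sub>R z) = r *\<^sub>R cvec z"
  "cvec 0 = 0"
  by (simp_all add: vec_eq_iff forall_2)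

lemma norm_cvec [simp]: "norm (cvec z) = cmod z"
  by (simp add: norm_vec_def L2_set_def sum_2 cmod_def)

lemma bounded_linear_cvec: "bounded_linear cvec"
  by (rule bounded_linear_intro[where K = 1]) (simp_all add: cvec_simps)

lemma cvec_eq_iff [simp]: "cvec y = cvec z \<longleftrightarrow> y = z"
  by (simp add: vec_eq_iff forall_2 complex_eq_iff)

lemma cvec_surj: obtains z where "v = cvec z"
  by (rule that[of "Complex (v $ 1) (v $ 2)"]) (simp add: vec_eq_iff forall_2)

lemma rot_cvec: "rot \<theta> *v cvec z = cvec (cis \<theta> * z)"
  by (simp add: vec_eq_iff forall_2 rot_def matrix_vector_mult_def sum_2 algebra_simps)

text \<open>Discrete Fourier synthesis on three points, with exponents of \<open>\<omega>\<close>
  reduced modulo 3. The \<open>a\<close> part is an equilateral triangle run counterclockwise, the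
  \<open>b\<close> part one run clockwise.\<close>

definition config :: "complex \<Rightarrow> complex \<Rightarrow> complex \<Rightarrow> real ^ 2 ^ 3" where
  "config s a b = vector [cvec (s + a + b), cvec (s + \<omega> * a + \<omega>\<^sup>2 * b), cvec (s + \<omega>\<^sup>2 * a + \<omega> * b)]"

lemma config_nth [simp]:
  "config s a b $ 1 = cvec (s + a + b)"
  "config s a b $ 2 = cvec (s + \<omega> * a + \<omega>\<^sup>2 * b)"
  "config s a b $ 3 = cvec (s + \<omega>\<^sup>2 * a + \<omega> * b)"
  by (simp_all add: config_def)

lemma config_surj: obtains s a b where "X = config s a b"
proof -
  obtain x y z where xyz: "X $ 1 = cvec x" "X $ 2 = cvec y" "X $ 3 = cvec z"
    by (metis cvec_surj)
  show ?thesis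
    \<comment> \<open>The witnesses are the inverse discrete Fourier transform, with
      \<open>\<omega>\<^sup>2\<close> as the inverse of \<open>\<omega>\<close>.\<close>
    by (rule that[of "(x + y + z) / 3" "(x + \<omega>\<^sup>2 * y + \<omega> * z) / 3" "(x + \<omega> * y + \<omega>\<^sup>2 * z) / 3"])
       (simp add: vec_eq_iff[of X] forall_3 xyz field_simps power2_eq_square omega_mult)
qed

lemma config_diff: "config s a b - config s' a' b' = config (s - s') (a - a') (b - b')"
  by (simp add: vec_eq_iff[where 'b = 3] forall_3 flip: cvec_simps) (simp add: algebra_simps)

lemma config_scaleR: "r *\<^sub>R config s a b = config (r *\<^sub>R s) (r *\<^sub>R a) (r *\<^sub>R b)"
  by (simp add: vec_eq_iff[where 'b = 3] forall_3 scaleR_add_right flip: cvec_simps)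

lemma rot_config_config: "rot_config \<theta> (config s a b) = config (cis \<theta> * s) (cis \<theta> * a) (cis \<theta> * b)"
  by (simp add: vec_eq_iff[where 'b = 3] forall_3 rot_config_def rot_cvec) (simp add: algebra_simps)

lemma barycenter_config: "barycenter (config s a b) = cvec s"
proof -
  have "(s + a + b) + (s + \<omega> * a + \<omega>\<^sup>2 * b) + (s + \<omega>\<^sup>2 * a + \<omega> * b) = 3 *\<^sub>R s"
    by (simp add: algebra_simps omega_square scaleR_conv_of_real)
  then show ?thesis
    by (simp add: barycenter_def sum_3 flip: cvec_simps)
qed

lemma const_config: "(\<chi> j. cvec s) = config s 0 0"
  by (simp add: vec_eq_iff[where 'b = 3] forall_3)

lemma norm_config_le: "norm (config 0 0 b) \<le> 3 * cmod b"
proof -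
  have "norm (config 0 0 b) \<le> (\<Sum>j\<in>UNIV. norm (config 0 0 b $ j))"
    unfolding norm_vec_def[of "config 0 0 b"] by (rule L2_set_le_sum) simp
  then show ?thesis by (simp add: sum_3 norm_mult norm_power)
qed

text \<open>By Fourier inversion three times each coefficient is a sum of the columns with
  unimodular weights, and no column exceeds the norm of the configuration.\<close>

lemma norm_config_ge:
  "cmod a \<le> norm (config s a b)" "cmod b \<le> norm (config s a b)"
proof -
  define x y z where "x = s + a + b" and "y = s + \<omega> * a + \<omega>\<^sup>2 * b" and "z = s + \<omega>\<^sup>2 * a + \<omega> * b"
  have le: "cmod x \<le> norm (config s a b)" "cmod y \<le> norm (config s a b)" "cmod z \<le> norm (config s a b)"
    using Finite_Cartesian_Product.norm_nth_le[of "config s a b" 1]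
      Finite_Cartesian_Product.norm_nth_le[of "config s a b" 2]
      Finite_Cartesian_Product.norm_nth_le[of "config s a b" 3]
    by (simp_all add: x_def y_def z_def)
  have tri: "cmod (x + \<zeta> * y + \<eta> * z) \<le> 3 * norm (config s a b)" if "cmod \<zeta> = 1" "cmod \<eta> = 1" for \<zeta> \<eta>
    using le norm_triangle_ineq[of "x + \<zeta> * y" "\<eta> * z"] norm_triangle_ineq[of x "\<zeta> * y"] that
    by (simp add: norm_mult)
  have "x + \<omega>\<^sup>2 * y + \<omega> * z = 3 * a" "x + \<omega> * y + \<omega>\<^sup>2 * z = 3 * b"
    by (simp_all add: x_def y_def z_def algebra_simps power2_eq_square omega_mult)
  then show "cmod a \<le> norm (config s a b)" "cmod b \<le> norm (config s a b)"
    using tri[of "\<omega>\<^sup>2" \<omega>] tri[of \<omega> "\<omega>\<^sup>2"] by (simp_all add: norm_mult norm_power)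
qed

text \<open>Each side is a fixed constant times one of the linear factors of
  \<open>a ^ 3 - b ^ 3\<close>. Hence the pair interactions turn into the poles of
  \<open>flow_a\<close> and \<open>flow_b\<close>.\<close>

lemma config_sides:
  "(s + a + b) - (s + \<omega> * a + \<omega>\<^sup>2 * b) = (1 - \<omega>) * (a - \<omega>\<^sup>2 * b)"
  "(s + a + b) - (s + \<omega>\<^sup>2 * a + \<omega> * b) = (1 - \<omega>\<^sup>2) * (a - \<omega> * b)"
  "(s + \<omega> * a + \<omega>\<^sup>2 * b) - (s + \<omega>\<^sup>2 * a + \<omega> * b) = (\<omega> - \<omega>\<^sup>2) * (a - b)"
  by (simp_all add: algebra_simps power2_eq_square omega_mult)

lemma omega_diff_nonzero: "1 - \<omega> \<noteq> 0" "1 - \<omega>\<^sup>2 \<noteq> 0" "\<omega> - \<omega>\<^sup>2 \<noteq> 0"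
  by (simp_all add: omega_square) (simp_all add: omega_eq complex_eq_iff)

text \<open>These come from \<open>(1 - \<omega>) * (1 - \<omega>\<^sup>2) = 3\<close> and
  \<open>(\<omega> - \<omega>\<^sup>2)\<^sup>2 = - 3\<close>.\<close>

lemma omega_diff_inverse:
  "1 / (1 - \<omega>) = (1 - \<omega>\<^sup>2) / 3" "1 / (1 - \<omega>\<^sup>2) = (1 - \<omega>) / 3" "1 / (\<omega> - \<omega>\<^sup>2) = (\<omega>\<^sup>2 - \<omega>) / 3"
  using omega_diff_nonzero
  by (simp_all add: divide_simps algebra_simps power2_eq_square omega_mult)

lemma config_in_distinct_configs:
  assumes "cmod b < cmod a"
  shows "config s a b \<in> distinct_configs"
proof -
  have "config s a b $ 1 \<noteq> config s a b $ 2" "config s a b $ 1 \<noteq> config s a b $ 3"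
    "config s a b $ 2 \<noteq> config s a b $ 3"
    using cube_root_factors_nonzero[OF assms] omega_diff_nonzero config_sides[of s a b]
    by (metis config_nth cvec_eq_iff eq_iff_diff_eq_0 mult_eq_0_iff)+
  then show ?thesis
    unfolding distinct_configs_def by (simp add: forall_3 del: config_nth)
qed

section \<open>The three-point system in Fourier coordinates\<close>

lemma UNIV_minus_singleton_3: "UNIV - {1} = {2, 3::3}" "UNIV - {2} = {1, 3::3}" "UNIV - {3} = {1, 2::3}"
  unfolding UNIV_3 by auto

text \<open>The strengths enter only through the product \<open>\<sigma> * \<sigma>\<close>, so both
  signs give the same motion. Keeping \<open>j\<close>, \<open>k\<close>, \<open>l\<close> general
  lets one computation serve all three vertices.\<close>

lemma velocity_triangle:
  fixes m :: "3 \<Rightarrow> real"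
  assumes X: "X $ j = cvec x" "X $ k = cvec y" "X $ l = cvec z"
    and jkl: "UNIV - {j} = {k, l}" "k \<noteq> l"
    and m: "\<And>j. m j = \<sigma>" "\<sigma> * \<sigma> = 1"
  shows "velocity m X j = cvec (2 * cnj (1 / (x - y) + 1 / (x - z)))"
proof -
  have pair: "(\<sigma> / (cmod w)\<^sup>2) *\<^sub>R cvec w = \<sigma> *\<^sub>R cvec (cnj (1 / w))" for w
    unfolding cnj_inverse_eq_scaleR cvec_simps by simp
  have "velocity m X j = (2 * (\<sigma> * \<sigma>)) *\<^sub>R (cvec (cnj (1 / (x - y))) + cvec (cnj (1 / (x - z))))"
    unfolding velocity_def jkl(1) using jkl(2)
    by (simp only: sum.insert sum.empty finite.intros insert_iff empty_iff X m(1) norm_cvec pair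
        simp_thms add_0_right scaleR_add_right scaleR_scaleR mult.assoc flip: cvec_simps(2))
  moreover have "2 *\<^sub>R (cvec (cnj p) + cvec (cnj q)) = cvec (2 * cnj (p + q))" for p q
    by (simp add: vec_eq_iff forall_2)
  ultimately show ?thesis by (simp only: m(2) mult_1_right)
qed

text \<open>Inverting the factored sides expresses each velocity through the poles, to be matched
  column by column with the synthesis of the two flows. The first argument 0 on the right says that
  the barycenter is at rest.\<close>

lemma velocity_config:
  fixes m :: "3 \<Rightarrow> real"
  assumes m: "\<And>j. m j = \<sigma>" "\<sigma> * \<sigma> = 1"
  shows "velocity m (config s a b) j = config 0 (flow_a a b) (flow_b a b) $ j"
proof -
  \<comment> \<open>The thirds absorb the denominators 3 from
    \<open>omega_diff_inverse\<close>.\<close>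
  define P Q R where "P = 1 / (a - b) / 3" and "Q = 1 / (a - \<omega> * b) / 3" and "R = 1 / (a - \<omega>\<^sup>2 * b) / 3"
  define x y z where "x = s + a + b" and "y = s + \<omega> * a + \<omega>\<^sup>2 * b" and "z = s + \<omega>\<^sup>2 * a + \<omega> * b"
  note nth = config_nth[of s a b, folded x_def y_def z_def]
  \<comment> \<open>Conjugation swaps \<open>\<omega>\<close> and \<open>\<omega>\<^sup>2\<close>.
    This moves the Fourier weights under one conjugation, leaving an identity between linear
    combinations of \<open>P\<close>, \<open>Q\<close>, \<open>R\<close>.\<close>
  have cnj_omega: "\<omega> = cnj (\<omega>\<^sup>2)" "\<omega>\<^sup>2 = cnj \<omega>"
    by (simp_all add: omega_square) (simp_all add: omega_eq complex_eq_iff)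
  have inv_mult: "1 / (p * w) = p' * (1 / w / 3)" if "1 / p = p' / 3" for p p' w :: complex
    using that by (simp flip: divide_divide_eq_left)
  have inv: "1 / (x - y) = (1 - \<omega>\<^sup>2) * R" "1 / (x - z) = (1 - \<omega>) * Q" "1 / (y - z) = (\<omega>\<^sup>2 - \<omega>) * P"
    unfolding x_def y_def z_def config_sides P_def Q_def R_def by (rule inv_mult omega_diff_inverse)+
  have inv': "1 / (y - x) = - ((1 - \<omega>\<^sup>2) * R)" "1 / (z - x) = - ((1 - \<omega>) * Q)"
    "1 / (z - y) = - ((\<omega>\<^sup>2 - \<omega>) * P)"
    unfolding inv[symmetric] by (simp_all add: divide_simps)
  have flow: "flow_a a b = cnj (2 * (P + Q + R))" "flow_b a b = cnj (- 2 * (P + \<omega> * Q + \<omega>\<^sup>2 * R))"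
    by (simp_all add: flow_a_def flow_b_def P_def Q_def R_def scaleR_conv_of_real algebra_simps)
  have two: "2 * cnj w = cnj (2 * w)" for w by simp
  have "velocity m (config s a b) 1 = config 0 (flow_a a b) (flow_b a b) $ 1"
  proof -
    have "velocity m (config s a b) 1 = cvec (2 * cnj (1 / (x - y) + 1 / (x - z)))"
      by (rule velocity_triangle[OF nth(1,2,3) _ _ m]) (simp_all add: UNIV_minus_singleton_3)
    also have "2 * cnj (1 / (x - y) + 1 / (x - z)) = flow_a a b + flow_b a b"
      unfolding inv flow two complex_cnj_add[symmetric]
      by (rule arg_cong[where f = cnj]) (simp add: algebra_simps)
    finally show ?thesis by simp
  qed
  moreover have "velocity m (config s a b) 2 = config 0 (flow_a a b) (flow_b a b) $ 2"
  proof -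
    have "velocity m (config s a b) 2 = cvec (2 * cnj (1 / (y - x) + 1 / (y - z)))"
      by (rule velocity_triangle[OF nth(2,1,3) _ _ m]) (simp_all add: UNIV_minus_singleton_3)
    also have "2 * cnj (1 / (y - x) + 1 / (y - z)) = cnj (\<omega>\<^sup>2) * flow_a a b + cnj \<omega> * flow_b a b"
      unfolding inv inv' flow two complex_cnj_add[symmetric] complex_cnj_mult[symmetric]
      by (rule arg_cong[where f = cnj]) (simp add: algebra_simps power2_eq_square omega_mult)
    finally show ?thesis by (simp only: cnj_omega[symmetric] config_nth add_0_left)
  qed
  moreover have "velocity m (config s a b) 3 = config 0 (flow_a a b) (flow_b a b) $ 3"
  proof -
    have "velocity m (config s a b) 3 = cvec (2 * cnj (1 / (z - x) + 1 / (z - y)))"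
      by (rule velocity_triangle[OF nth(3,1,2) _ _ m]) (simp_all add: UNIV_minus_singleton_3)
    also have "2 * cnj (1 / (z - x) + 1 / (z - y)) = cnj \<omega> * flow_a a b + cnj (\<omega>\<^sup>2) * flow_b a b"
      unfolding inv inv' flow two complex_cnj_add[symmetric] complex_cnj_mult[symmetric]
      by (rule arg_cong[where f = cnj]) (simp add: algebra_simps power2_eq_square omega_mult)
    finally show ?thesis by (simp only: cnj_omega[symmetric] config_nth add_0_left)
  qed
  ultimately have "\<forall>j. velocity m (config s a b) j = config 0 (flow_a a b) (flow_b a b) $ j"
    unfolding forall_3 by (intro conjI)
  then show ?thesis ..
qed

lemma config_is_solution:
  fixes m :: "3 \<Rightarrow> real"
  assumes m: "\<And>j. m j = \<sigma>" "\<sigma> * \<sigma> = 1"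
    and a: "\<And>t. t \<ge> 0 \<Longrightarrow> (a has_vector_derivative flow_a (a t) (b t)) (at t within {0..})"
    and b: "\<And>t. t \<ge> 0 \<Longrightarrow> (b has_vector_derivative flow_b (a t) (b t)) (at t within {0..})"
    and lt: "\<And>t. t \<ge> 0 \<Longrightarrow> cmod (b t) < cmod (a t)"
  shows "is_solution m (\<lambda>t. config s (a t) (b t))"
  unfolding is_solution_def
proof (intro allI impI conjI config_in_distinct_configs lt)
  fix t :: real and j :: 3 assume t: "t \<ge> 0"
  have comb: "((\<lambda>t. cvec (s + \<zeta> * a t + \<eta> * b t)) has_vector_derivative
      cvec (\<zeta> * flow_a (a t) (b t) + \<eta> * flow_b (a t) (b t))) (at t within {0..})" for \<zeta> \<eta>
    by (intro bounded_linear.has_vector_derivative[OF bounded_linear_cvec])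
       (auto intro!: derivative_eq_intros a b t)
  have "\<forall>j. ((\<lambda>t. config s (a t) (b t) $ j) has_vector_derivative
      config 0 (flow_a (a t) (b t)) (flow_b (a t) (b t)) $ j) (at t within {0..})"
    using comb[of 1 1] comb[of \<omega> "\<omega>\<^sup>2"] comb[of "\<omega>\<^sup>2" \<omega>] by (simp add: forall_3)
  then show "((\<lambda>t. config s (a t) (b t) $ j) has_vector_derivative
      velocity m (config s (a t) (b t)) j) (at t within {0..})"
    by (simp only: velocity_config[OF m])
qed

section \<open>The self-similar solution and its orbital stability\<close>

lemma regular_triangles_config:
  assumes "norm e = 1" "X \<in> regular_triangles e \<theta>\<^sub>0"
  obtains a where "X = config 0 a 0" "a \<noteq> 0"
proof -
  obtain z where z: "e = cvec z" by (rule cvec_surj)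
  obtain r where r: "r > 0" "X = vector (map (\<lambda>j. r *\<^sub>R (rot (2 * (j - 1) * pi / 3 + \<theta>\<^sub>0) *v e)) [1, 2, 3])"
    using assms by (auto simp: regular_triangles_def)
  define a where "a = r *\<^sub>R (cis \<theta>\<^sub>0 * z)"
  have "cis (2 * (2 - 1) * pi / 3 + \<theta>\<^sub>0) = \<omega> * cis \<theta>\<^sub>0" "cis (2 * (3 - 1) * pi / 3 + \<theta>\<^sub>0) = \<omega>\<^sup>2 * cis \<theta>\<^sub>0"
    by (simp_all add: \<omega>_def cis_mult power2_eq_square algebra_simps)
  then have "X = config 0 a 0"
    unfolding r(2) z
    by (simp add: vec_eq_iff[where 'b = 3] forall_3 rot_cvec a_def algebra_simps flip: cvec_simps)
  moreover have "a \<noteq> 0" using r(1) assms(1) z by (auto simp: a_def)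
  ultimately show ?thesis using that by blast
qed

text \<open>At \<open>b = 0\<close> the flow of \<open>b\<close> vanishes because 1,
  \<open>\<omega>\<close> and \<open>\<omega>\<^sup>2\<close> sum to 0, and that of \<open>a\<close>
  is \<open>2 / (cmod a)\<^sup>2\<close> times \<open>a\<close>: the direction is kept and the
  squared modulus grows at rate 4.\<close>

lemma self_similar_solution:
  fixes m :: "3 \<Rightarrow> real"
  assumes m: "\<And>j. m j = \<sigma>" "\<sigma> * \<sigma> = 1" and "a \<noteq> 0"
  shows "is_solution m (\<lambda>t. config 0 ((1 / cmod a * sqrt (4 * t + (cmod a)\<^sup>2)) *\<^sub>R a) 0)"
proof (rule config_is_solution[OF m])
  fix t :: real assume "t \<ge> 0"
  define q where "q = sqrt (4 * t + (cmod a)\<^sup>2)"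
  have pos: "4 * t + (cmod a)\<^sup>2 > 0" using \<open>a \<noteq> 0\<close> \<open>t \<ge> 0\<close> by (simp add: add_nonneg_pos)
  then have q: "q > 0" by (simp add: q_def)
  then show "cmod 0 < cmod ((1 / cmod a * sqrt (4 * t + (cmod a)\<^sup>2)) *\<^sub>R a)"
    using assms by (simp add: q_def)
  show "((\<lambda>t. 0) has_vector_derivative
      flow_b ((1 / cmod a * sqrt (4 * t + (cmod a)\<^sup>2)) *\<^sub>R a) 0) (at t within {0..})"
    using omega_square by (simp add: flow_b_def add_divide_distrib[symmetric] flip: complex_cnj_add)
  have "((\<lambda>t. 1 / cmod a * sqrt (4 * t + (cmod a)\<^sup>2)) has_real_derivative 2 / (cmod a * q)) (at t within {0..})"
    using pos \<open>a \<noteq> 0\<close> by (auto intro!: derivative_eq_intros simp: q_def field_simps)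
  from has_vector_derivative_scaleR[OF this has_vector_derivative_const]
  have "((\<lambda>t. (1 / cmod a * sqrt (4 * t + (cmod a)\<^sup>2)) *\<^sub>R a) has_vector_derivative (2 / (cmod a * q)) *\<^sub>R a)
      (at t within {0..})"
    by simp
  moreover have "flow_a ((1 / cmod a * q) *\<^sub>R a) 0 = (2 / (cmod a * q)) *\<^sub>R a"
    unfolding flow_a_def mult_zero_right diff_zero cnj_inverse_eq_scaleR
    using q assms by (simp add: field_simps power2_eq_square flip: scaleR_add_left)
  ultimately show "((\<lambda>t. (1 / cmod a * sqrt (4 * t + (cmod a)\<^sup>2)) *\<^sub>R a) has_vector_derivative
      flow_a ((1 / cmod a * sqrt (4 * t + (cmod a)\<^sup>2)) *\<^sub>R a) 0) (at t within {0..})"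
    by (simp add: q_def)
qed

text \<open>Scaling and rotation together act on the reference triangle as multiplication by any
  nonzero complex number, so they match the \<open>a\<close> part exactly and only the
  \<open>b\<close> part remains. Hence no estimate on the phase or size of \<open>a\<close> relative
  to the reference is needed.\<close>

lemma dist_to_orbit_le:
  assumes "\<alpha> \<noteq> 0" "q > 0" "a \<noteq> 0"
  shows "(INF (r, \<theta>)\<in>{0<..} \<times> {0..<2 * pi}.
      ereal (norm (config s a b - (\<chi> j. cvec s) - r *\<^sub>R rot_config \<theta> (config 0 (q *\<^sub>R \<alpha>) 0))))
    \<le> ereal (3 * cmod b)"
proof -
  \<comment> \<open>Polar form of \<open>a / \<alpha>\<close>; \<open>Arg2pi\<close> takes values in
    the required range from 0 to \<open>2 * pi\<close>, and dividing by \<open>q\<close> compensates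
    the current size of the reference triangle.\<close>
  define \<theta> r where "\<theta> = Arg2pi (a / \<alpha>)" and "r = cmod (a / \<alpha>) / q"
  have "a / \<alpha> = cmod (a / \<alpha>) * cis \<theta>"
    using Arg2pi_eq[of "a / \<alpha>"] by (simp add: \<theta>_def cis_conv_exp)
  then have "r *\<^sub>R (cis \<theta> * (q *\<^sub>R \<alpha>)) = a"
    using assms by (simp add: r_def scaleR_conv_of_real field_simps)
  then have eq: "config s a b - (\<chi> j. cvec s) - r *\<^sub>R rot_config \<theta> (config 0 (q *\<^sub>R \<alpha>) 0) = config 0 0 b"
    by (simp add: const_config rot_config_config config_scaleR config_diff)
  have "(r, \<theta>) \<in> {0<..} \<times> {0..<2 * pi}"
    using assms Arg2pi[of "a / \<alpha>"] by (auto simp: r_def \<theta>_def)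
  then have "(INF (r, \<theta>)\<in>{0<..} \<times> {0..<2 * pi}.
      ereal (norm (config s a b - (\<chi> j. cvec s) - r *\<^sub>R rot_config \<theta> (config 0 (q *\<^sub>R \<alpha>) 0))))
    \<le> ereal (norm (config 0 0 b))"
    by (rule INF_lower2) (simp add: eq)
  also have "\<dots> \<le> ereal (3 * cmod b)" using norm_config_le by simp
  finally show ?thesis .
qed

theorem theorem3p2:
  fixes e :: "real ^ 2" and \<theta>\<^sub>0 r\<^sub>0 :: real
    and X0 :: "real ^ 2 ^ 3" and Xt :: "real \<Rightarrow> real ^ 2 ^ 3"
    and m :: "3 \<Rightarrow> real"
  assumes "norm e = 1"
    and "X0 \<in> regular_triangles e \<theta>\<^sub>0"
    and "r\<^sub>0 = norm (X0 $ 1)"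
    and "\<And>t. Xt t = (1 / r\<^sub>0 * sqrt (4 * t + r\<^sub>0\<^sup>2)) *\<^sub>R X0"
    and "m 1 = m 2" and "m 2 = m 3" and "m 1 \<in> {1, -1}"
  shows "is_solution m Xt \<and> orbitally_stable m Xt"
proof
  obtain \<alpha> where \<alpha>: "X0 = config 0 \<alpha> 0" "\<alpha> \<noteq> 0"
    using regular_triangles_config[OF assms(1,2)] .
  have r\<^sub>0: "r\<^sub>0 = cmod \<alpha>" using assms(3) \<alpha> by simp
  define q where "q t = 1 / cmod \<alpha> * sqrt (4 * t + (cmod \<alpha>)\<^sup>2)" for t
  have Xt: "Xt t = config 0 (q t *\<^sub>R \<alpha>) 0" for t
    by (simp add: assms(4) \<alpha>(1) r\<^sub>0 q_def config_scaleR)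
  have m: "m j = m 1" "m 1 * m 1 = 1" for j
    using assms(5-7) exhaust_3[of j] by auto
  show "is_solution m Xt"
    using self_similar_solution[OF m \<alpha>(2)] by (simp add: Xt[abs_def] q_def)
  have q: "q t > 0" if "t \<ge> 0" for t
    using \<alpha>(2) that by (simp add: q_def add_nonneg_pos)
  have q0: "q 0 = 1" using \<alpha>(2) by (simp add: q_def)
  show "orbitally_stable m Xt"
    unfolding orbitally_stable_def
  proof (intro allI impI)
    fix \<epsilon> :: real assume "\<epsilon> > 0"
    \<comment> \<open>\<open>\<epsilon> / 6\<close> makes the orbit distance
      \<open>3 * \<rho>\<close> at most \<open>\<epsilon> / 2\<close>, leaving room for a strict
      inequality after the supremum. Since \<open>a\<^sub>0\<close> will have at least half the
      modulus of \<open>\<alpha>\<close>, the 16 yields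
      \<open>\<rho> \<le> cmod a\<^sub>0 / 8\<close>.\<close>
    define \<rho> where "\<rho> = min (\<epsilon> / 6) (cmod \<alpha> / 16)"
    have \<rho>: "\<rho> > 0" "3 * \<rho> < \<epsilon>" "\<rho> \<le> cmod \<alpha> / 16"
      using \<open>\<epsilon> > 0\<close> \<alpha>(2) by (auto simp: \<rho>_def min_def)
    show "\<exists>\<delta>>0. \<forall>X0\<in>distinct_configs. norm (X0 - Xt 0) < \<delta> \<longrightarrow>
      (\<exists>X. is_solution m X \<and> X 0 = X0 \<and>
        (\<forall>Y. is_solution m Y \<and> Y 0 = X0 \<longrightarrow> (\<forall>t\<ge>0. Y t = X t)) \<and>
        (SUP t\<in>{0..}. INF (r, \<theta>)\<in>{0<..} \<times> {0..<2 * pi}.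
          ereal (norm (X t - (\<chi> j. barycenter X0) - r *\<^sub>R rot_config \<theta> (Xt t)))) < ereal \<epsilon>)"
    \<comment> \<open>By \<open>norm_config_ge\<close> this radius controls both coefficients, in
      particular giving the initial bound \<open>\<rho> / 2\<close> on \<open>b\<^sub>0\<close> that
      the reduced flow requires.\<close>
    proof (intro exI[of _ "\<rho> / 2"] conjI ballI impI)
      fix Z assume "norm (Z - Xt 0) < \<rho> / 2"
      moreover obtain s a\<^sub>0 b\<^sub>0 where Z: "Z = config s a\<^sub>0 b\<^sub>0" by (rule config_surj)
      ultimately have "cmod (a\<^sub>0 - \<alpha>) < \<rho> / 2" "cmod b\<^sub>0 < \<rho> / 2"
        using norm_config_ge[where s = s and a = "a\<^sub>0 - \<alpha>" and b = b\<^sub>0] by (simp_all add: Xt q0 config_diff)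
      then have "cmod \<alpha> / 2 \<le> cmod a\<^sub>0"
        using norm_triangle_ineq2[of \<alpha> a\<^sub>0] \<rho> by (simp add: norm_minus_commute)
      then have "a\<^sub>0 \<noteq> 0" "\<rho> \<le> cmod a\<^sub>0 / 8" using \<rho> by auto
      then obtain a b where ab: "a 0 = a\<^sub>0" "b 0 = b\<^sub>0"
        "\<And>t. t \<ge> 0 \<Longrightarrow> (a has_vector_derivative flow_a (a t) (b t)) (at t within {0..})"
        "\<And>t. t \<ge> 0 \<Longrightarrow> (b has_vector_derivative flow_b (a t) (b t)) (at t within {0..})"
        "\<And>t. t \<ge> 0 \<Longrightarrow> cmod (b t) \<le> \<rho>"
        "\<And>t. t \<ge> 0 \<Longrightarrow> cmod a\<^sub>0 \<le> cmod (a t)"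
        using reduced_flow_global_solution[of a\<^sub>0 \<rho> b\<^sub>0] \<rho>(1) \<open>cmod b\<^sub>0 < \<rho> / 2\<close>
        by (metis less_eq_real_def)
      have lt: "cmod (b t) < cmod (a t)" if "t \<ge> 0" for t
        using ab(5,6)[OF that] \<open>\<rho> \<le> cmod a\<^sub>0 / 8\<close> \<rho>(1) by linarith
      define X where "X t = config s (a t) (b t)" for t
      have X: "is_solution m X" "X 0 = Z"
        using config_is_solution[OF m ab(3,4) lt] by (auto simp: X_def[abs_def] Z ab)
      have "(SUP t\<in>{0..}. INF (r, \<theta>)\<in>{0<..} \<times> {0..<2 * pi}.
          ereal (norm (X t - (\<chi> j. barycenter Z) - r *\<^sub>R rot_config \<theta> (Xt t)))) \<le> ereal (3 * \<rho>)"
      proof (rule SUP_least)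
        fix t :: real assume "t \<in> {0..}"
        then have t: "t \<ge> 0" by simp
        have "a t \<noteq> 0" using lt[OF t] by auto
        then show "(INF (r, \<theta>)\<in>{0<..} \<times> {0..<2 * pi}.
          ereal (norm (X t - (\<chi> j. barycenter Z) - r *\<^sub>R rot_config \<theta> (Xt t)))) \<le> ereal (3 * \<rho>)"
          unfolding X_def Xt Z barycenter_config
          by (intro order_trans[OF dist_to_orbit_le]) (use ab(5)[OF t] \<alpha>(2) q[OF t] in auto)
      qed
      also have "\<dots> < ereal \<epsilon>" using \<rho> by simp
      finally show "\<exists>X. is_solution m X \<and> X 0 = Z \<and>
        (\<forall>Y. is_solution m Y \<and> Y 0 = Z \<longrightarrow> (\<forall>t\<ge>0. Y t = X t)) \<and>
        (SUP t\<in>{0..}. INF (r, \<theta>)\<in>{0<..} \<times> {0..<2 * pi}.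
          ereal (norm (X t - (\<chi> j. barycenter Z) - r *\<^sub>R rot_config \<theta> (Xt t)))) < ereal \<epsilon>"
        using X solution_unique[of m _ X] by blast
    qed (use \<rho> in simp)
  qed
qed

end
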